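(* Let $p\ge 2$ be an integer and let $k,m$ be non-negative integers with $k\ge m-1$ and $k+m\ge 1$. Let $P_{km}/Q_{km}$ be the $[k/m]$ Padé approximant of $(1-z)^{-1/p}$, and let $x_0\in\mathbb{C}$ satisfy $|1-x_0^p|<1$. Let $(x_l)_{l\ge 0}$ be the sequence generated by $$x_{l+1}=x_l\,\frac{P_{km}(1-x_l^p)}{Q_{km}(1-x_l^p)},\qquad l\ge 0.$$ Put $$\alpha=\frac{p\,k!\,m!\left(\frac1p\right)_{k+1}\left(1-\frac1p\right)_m}{(k+m)!\,(k+m+1)!}.$$ Then $\alpha<1$, and for every integer $l\ge 0$, $$|1-x_l^p|\le |1-x_0^p|^{(k+m+1)^l}\left(\frac{|1-x_0^p|+\alpha}{1+\alpha|1-x_0^p|}\right)^{\left((k+m+1)^l-1\right)/(k+m)}.$$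
   Context: Pochhammer symbol: $(\alpha)_0=1$ and $(\alpha)_j=\alpha(\alpha+1)\cdots(\alpha+j-1)$ for $j\ge 1$. The numerator and denominator of the $[k/m]$ Padé approximant of $(1-z)^{-1/p}$ are the polynomials $$P_{km}(z)=\sum_{j=0}^{k}\frac{(-k)_j\left(\frac1p-m\right)_j}{j!\,(-k-m)_j}z^j,\qquad Q_{km}(z)=\sum_{j=0}^{m}\frac{(-m)_j\left(-\frac1p-k\right)_j}{j!\,(-k-m)_j}z^j .$$ *)

theory Defs
  imports Complex_Main
begin

text \<open>
  Numerator and denominator of the \<open>[k/m]\<close> Pade approximant of \<open>(1 - z) powr (-1/p)\<close>.
  The divisors \<open>(-k-m)\<^sub>j\<close> do not vanish in the ranges of summation, as \<open>j \<le> k + m\<close> there.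
\<close>

definition pade_num :: "nat \<Rightarrow> nat \<Rightarrow> nat \<Rightarrow> complex \<Rightarrow> complex" where
  "pade_num p k m z =
     (\<Sum>j=0..k. pochhammer (- of_nat k) j * pochhammer (1 / of_nat p - of_nat m) j
                  / (fact j * pochhammer (- of_nat k - of_nat m) j) * z ^ j)"

definition pade_den :: "nat \<Rightarrow> nat \<Rightarrow> nat \<Rightarrow> complex \<Rightarrow> complex" where
  "pade_den p k m z =
     (\<Sum>j=0..m. pochhammer (- of_nat m) j * pochhammer (- (1 / of_nat p) - of_nat k) j
                  / (fact j * pochhammer (- of_nat k - of_nat m) j) * z ^ j)"

definition pade_alpha :: "nat \<Rightarrow> nat \<Rightarrow> nat \<Rightarrow> real" where
  "pade_alpha p k m =
     real p * fact k * fact m * pochhammer (1 / real p) (k + 1) * pochhammer (1 - 1 / real p) m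
       / (fact (k + m) * fact (k + m + 1))"

end

theory Submission
  imports Defs "HOL-Complex_Analysis.Cauchy_Integral_Formula"
begin

text \<open>
  Write \<open>a = 1/p\<close>. Along a staircase of the Pade table, \<open>(k,m) \<rightarrow> (k,m+1) \<rightarrow> (k+1,m+1) \<rightarrow> \<dots>\<close>
  starting in the column \<open>m = 0\<close>, numerators and denominators satisfy the same recurrence
  \<open>Y\<^sub>2 = Y\<^sub>1 - b z Y\<^sub>0\<close> with \<open>b \<ge> 0\<close>. Hence \<open>Q\<^sub>1/Q\<^sub>2 = 1/(1 - b z Q\<^sub>0/Q\<^sub>1)\<close> inherits
  nonnegative Taylor coefficients from \<open>Q\<^sub>0/Q\<^sub>1\<close>, and so do \<open>1/Q\<close> and, as
  \<open>P\<^sub>2/Q\<^sub>2 - P\<^sub>1/Q\<^sub>1\<close> is \<open>c z\<^sup>n/(Q\<^sub>1Q\<^sub>2)\<close> with \<open>c \<ge> 0\<close>, also \<open>P/Q\<close>.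
  The same recurrence bounds \<open>|Q\<^sub>2/Q\<^sub>1|\<close> below on the closed unit disc.

  The hypergeometric equations of \<open>P\<close> and \<open>Q\<close> show that \<open>a P Q - (1 - z) (P' Q - P Q')\<close> is a
  multiple of \<open>z\<close> to the power \<open>k + m\<close>, so the residual \<open>F = 1 - (1 - z) (P/Q)^p\<close> has the
  derivative \<open>F' = (k + m + 1) \<alpha> z^(k+m) (P/Q)^(p-1) / Q\<^sup>2\<close>. Thus \<open>F\<close> has nonnegative coefficients,
  the leading term \<open>\<alpha> z^(k+m+1)\<close>, and coefficient sum at most \<open>1\<close>, because \<open>F \<le> 1\<close> on \<open>[0,1)\<close>.
  This gives \<open>|F(z)| \<le> t^(k+m+1) (\<alpha> + (1 - \<alpha>) t)\<close> for \<open>t = |z| < 1\<close>, and the chord \<open>\<alpha> + (1 - \<alpha>) t\<close>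
  lies below \<open>(t + \<alpha>)/(1 + \<alpha> t)\<close>. The iteration maps \<open>1 - x\<^sub>l^p\<close> to \<open>F (1 - x\<^sub>l^p)\<close>.
\<close>

section \<open>Recurrences in the Pade table\<close>

text \<open>This is \<open>(-m)_j / (j! (-k-m)_j)\<close> with the signs cancelled, times the
  remaining Pochhammer factor. The binomial vanishes for \<open>j > m\<close>, whatever the
  truncated subtraction gives there, so the recurrences need no range for \<open>j\<close>.\<close>

definition pade_coeff :: "'a::field_char_0 \<Rightarrow> nat \<Rightarrow> nat \<Rightarrow> nat \<Rightarrow> 'a" where
  "pade_coeff a k m j = of_nat (m choose j) * fact (k + m - j) / fact (k + m) * pochhammer (- a - of_nat k) j"

text \<open>
  \<open>pade_poly a k m\<close> is the denominator of the \<open>[k/m]\<close> approximant of \<open>(1 - z) powr (-a)\<close>;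
  exchanging numerator and denominator replaces \<open>a\<close> by \<open>-a\<close>, so the numerator is \<open>pade_poly (-a) m k\<close>.
\<close>

definition pade_poly :: "'a::field_char_0 \<Rightarrow> nat \<Rightarrow> nat \<Rightarrow> 'a poly" where
  "pade_poly a k m = (\<Sum>j\<le>m. monom (pade_coeff a k m j) j)"

lemma coeff_pade_poly: "coeff (pade_poly a k m) j = pade_coeff a k m j"
proof -
  have "coeff (pade_poly a k m) j = (\<Sum>i\<le>m. if i = j then pade_coeff a k m i else 0)"
    by (simp add: pade_poly_def coeff_sum)
  also have "\<dots> = pade_coeff a k m j"
    by (simp add: pade_coeff_def)
  finally show ?thesis .
qed

lemma degree_pade_poly: "degree (pade_poly a k m) \<le> m"
  by (rule degree_le) (auto simp: coeff_pade_poly pade_coeff_def)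

lemma pade_coeff_0 [simp]: "pade_coeff a k m 0 = 1"
  by (simp add: pade_coeff_def)

lemma pade_poly_0_right: "pade_poly a k 0 = 1"
  by (simp add: pade_poly_def pade_coeff_def)

lemma choose_Suc_mult:
  assumes "j \<le> m"
  shows "of_nat (m choose Suc j) * (of_nat j + 1 :: 'a::field_char_0) = of_nat (m choose j) * (of_nat m - of_nat j)"
proof -
  have "Suc j * (m choose Suc j) = (m - j) * (m choose j)"
    by (metis binomial_absorb_comp binomial_absorption diff_Suc_1' mult.commute binomial_fact_lemma)
  hence "of_nat (Suc j * (m choose Suc j)) = (of_nat ((m - j) * (m choose j)) :: 'a)" by simp
  thus ?thesis using assms by (simp add: of_nat_diff algebra_simps)
qed

lemma pade_coeff_Suc_right:
  fixes a :: "'a::field_char_0"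
  shows "pade_coeff a (Suc k) (Suc m) (Suc j) = pade_coeff a (Suc k) m (Suc j) -
    (a + of_nat (Suc k)) * of_nat (Suc k) / (of_nat (Suc k + m) * of_nat (Suc k + m + 1)) * pade_coeff a k m j"
proof (cases "j \<le> m")
  case True
  \<comment> \<open>Factorials enter only as letters here: once the common factor is taken out, a
    small identity between binomials remains.\<close>
  have comb: "x * (u * F) / (B * (A * G)) * w - y * F / (A * G) * w = (x * u - y * B) * (F / (G * A * B)) * w"
    if "A \<noteq> 0" "B \<noteq> 0" "G \<noteq> 0" for A B F G u w x y :: 'a
    using that by (simp add: field_simps)
  have comb': "K * C * (F / (G * A * B)) * ((- a - K) * R) = - ((a + K) * K / (A * B) * (C * F / G * R))"
    for A B C F G K R :: 'a
    by (simp add: divide_inverse algebra_simps)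
  obtain d where m: "m = j + d" using True le_Suc_ex by blast
  have ch: "of_nat (m choose Suc j) * (of_nat j + 1 :: 'a) = of_nat (m choose j) * of_nat d"
    using choose_Suc_mult[OF True, where 'a = 'a] by (simp add: m)
  have po: "pochhammer (- a - of_nat (Suc k)) (Suc j) = (- a - of_nat (Suc k)) * pochhammer (- a - of_nat k) j"
    by (simp add: pochhammer_rec)
  define F where "F = (fact (k + d) :: 'a)"
  define G where "G = (fact (k + m) :: 'a)"
  have f: "fact (Suc k + Suc m - Suc j) = (of_nat (k + d + 1)) * F"
          "fact (Suc k + m - Suc j) = F" "fact (k + m - j) = F"
          "fact (Suc k + Suc m) = of_nat (Suc k + m + 1) * (of_nat (Suc k + m) * G)"
          "fact (Suc k + m) = of_nat (Suc k + m) * G" "fact (k + m) = G"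
    by (simp_all add: m F_def G_def)
  define C where "C = (of_nat (m choose j) :: 'a)"
  define C' where "C' = (of_nat (m choose Suc j) :: 'a)"
  have cs: "of_nat (Suc m choose Suc j) = C + C'" by (simp add: C_def C'_def)
  define A where "A = (of_nat (Suc k + m) :: 'a)"
  have A1: "of_nat (Suc k + m + 1) = A + 1"
    by (simp add: A_def)
  have "of_nat (Suc k + m + 1) \<noteq> (0 :: 'a)" "of_nat (Suc k + m) \<noteq> (0 :: 'a)"
    by (simp_all only: of_nat_eq_0_iff)
  hence A: "of_nat (Suc k + m + 1) = A + 1" "A \<noteq> 0" "A + 1 \<noteq> 0" "G \<noteq> 0"
    unfolding A1 by (simp_all add: A_def G_def)
  have A2: "A = of_nat (Suc k) + of_nat j + of_nat d" by (simp add: A_def m)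
  \<comment> \<open>Pascal's rule has split the binomial into \<open>C + C'\<close>; absorption in
    \<open>ch\<close> cancels all but one term.\<close>
  have key: "(C + C') * of_nat (k + d + 1) - C' * (A + 1) = of_nat (Suc k) * C"
  proof -
    have "(C + C') * of_nat (k + d + 1) - C' * (A + 1) = C * of_nat (Suc k) + (C * of_nat d - C' * (of_nat j + 1))"
      by (simp add: A2 algebra_simps)
    thus ?thesis using ch by (simp add: C_def C'_def)
  qed
  have "pade_coeff a (Suc k) (Suc m) (Suc j) - pade_coeff a (Suc k) m (Suc j)
     = ((C + C') * of_nat (k + d + 1) - C' * (A + 1)) * (F / (G * A * (A + 1))) * ((- a - of_nat (Suc k)) * pochhammer (- a - of_nat k) j)"
    unfolding pade_coeff_def po f cs C'_def[symmetric] A(1) A_def[symmetric]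
    by (rule comb[OF A(2-4)])
  also have "\<dots> = - ((a + of_nat (Suc k)) * of_nat (Suc k) / (A * (A + 1)) * pade_coeff a k m j)"
    unfolding key unfolding pade_coeff_def f C_def[symmetric] by (rule comb')
  finally show ?thesis unfolding A(1) A_def[symmetric] by (simp add: algebra_simps)
next
  case False
  thus ?thesis by (simp add: pade_coeff_def binomial_eq_0)
qed

text \<open>Here the Pochhammer factors differ as well, but share
  \<open>pochhammer (- a - of_nat k) j\<close>. The rest is \<open>br\<close>, whose factor
  \<open>j + 1\<close> is absorbed by the binomial.\<close>

lemma pade_coeff_Suc_left:
  fixes a :: "'a::field_char_0"
  shows "pade_coeff a (Suc k) (Suc m) (Suc j) = pade_coeff a k (Suc m) (Suc j) -
    of_nat (Suc m) * (of_nat (Suc m) - a) / (of_nat (k + Suc m) * of_nat (k + Suc m + 1)) * pade_coeff a k m j"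
proof (cases "j \<le> m")
  case True
  have comb: "x * (u * F) / (B * (A * G)) * (v * R) - x * F / (A * G) * (R * w) = x * (u * v - B * w) * (F / (G * A * B) * R)"
    if "A \<noteq> 0" "B \<noteq> 0" "G \<noteq> 0" for A B F G R u v w x :: 'a
    using that by (simp add: field_simps)
  have comb': "M * C * (a - M) * (F / (G * A * B) * R) = - (M * (M - a) / (A * B) * (C * F / G * R))"
    for A B C F G M R :: 'a
    by (simp add: divide_inverse algebra_simps)
  obtain d where m: "m = j + d" using True le_Suc_ex by blast
  have "Suc m * (m choose j) = Suc j * (Suc m choose Suc j)"
    by (metis Suc_times_binomial_eq mult.commute)
  hence "of_nat (Suc m * (m choose j)) = (of_nat (Suc j * (Suc m choose Suc j)) :: 'a)" by simp
  hence ch: "of_nat (Suc m) * of_nat (m choose j) = of_nat (Suc j) * (of_nat (Suc m choose Suc j) :: 'a)"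
    by (simp only: of_nat_mult)
  define R where "R = pochhammer (- a - of_nat k) j"
  have po: "pochhammer (- a - of_nat (Suc k)) (Suc j) = (- a - of_nat (Suc k)) * R"
    by (simp add: pochhammer_rec R_def)
  have po': "pochhammer (- a - of_nat k) (Suc j) = R * (- a - of_nat k + of_nat j)"
    by (simp add: pochhammer_rec' R_def mult.commute)
  define F where "F = (fact (k + d) :: 'a)"
  define G where "G = (fact (k + m) :: 'a)"
  have f: "fact (Suc k + Suc m - Suc j) = (of_nat (k + d + 1)) * F"
          "fact (k + Suc m - Suc j) = F" "fact (k + m - j) = F"
          "fact (Suc k + Suc m) = of_nat (k + Suc m + 1) * (of_nat (k + Suc m) * G)"
          "fact (k + Suc m) = of_nat (k + Suc m) * G" "fact (k + m) = G"
    by (simp_all add: m F_def G_def)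
  define C where "C = (of_nat (m choose j) :: 'a)"
  define C' where "C' = (of_nat (Suc m choose Suc j) :: 'a)"
  define A where "A = (of_nat (k + Suc m) :: 'a)"
  have A1: "of_nat (k + Suc m + 1) = A + 1"
    by (simp add: A_def)
  have "of_nat (k + Suc m + 1) \<noteq> (0 :: 'a)" "of_nat (k + Suc m) \<noteq> (0 :: 'a)"
    by (simp_all only: of_nat_eq_0_iff)
  hence A: "of_nat (k + Suc m + 1) = A + 1" "A \<noteq> 0" "A + 1 \<noteq> 0" "G \<noteq> 0"
    unfolding A1 by (simp_all add: A_def G_def)
  have A2: "A = of_nat k + of_nat (Suc j) + of_nat d" and M: "of_nat (Suc m) = (of_nat (Suc j) + of_nat d :: 'a)"
    by (simp_all add: A_def m)
  have br: "of_nat (k + d + 1) * (- a - of_nat (Suc k)) - (A + 1) * (- a - of_nat k + of_nat j)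
      = of_nat (Suc j) * (a - of_nat (Suc m))"
    unfolding A2 M by (simp add: algebra_simps)
  have "pade_coeff a (Suc k) (Suc m) (Suc j) - pade_coeff a k (Suc m) (Suc j)
     = C' * (of_nat (k + d + 1) * (- a - of_nat (Suc k)) - (A + 1) * (- a - of_nat k + of_nat j)) * (F / (G * A * (A + 1)) * R)"
    unfolding pade_coeff_def po po' f C'_def[symmetric] A(1) A_def[symmetric]
    by (rule comb[OF A(2-4)])
  also have "\<dots> = (of_nat (Suc j) * C') * (a - of_nat (Suc m)) * (F / (G * A * (A + 1)) * R)"
    unfolding br by (simp only: mult_ac)
  also have "of_nat (Suc j) * C' = of_nat (Suc m) * C" using ch unfolding C_def C'_def by simp
  also have "of_nat (Suc m) * C * (a - of_nat (Suc m)) * (F / (G * A * (A + 1)) * R) = - (of_nat (Suc m) * (of_nat (Suc m) - a) / (A * (A + 1)) * pade_coeff a k m j)"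
    unfolding pade_coeff_def f C_def[symmetric] R_def[symmetric] by (rule comb')
  finally show ?thesis unfolding A(1) A_def[symmetric] by (simp add: algebra_simps)
next
  case False
  thus ?thesis by (simp add: pade_coeff_def binomial_eq_0)
qed

text \<open>Under \<open>a\<close> to \<open>-a\<close> and the exchange of \<open>k\<close> and
  \<open>m\<close>, \<open>pade_poly_Suc_left\<close> has this same factor; hence numerators and
  denominators obey one recurrence.\<close>

lemma pade_poly_Suc_right:
  "pade_poly a (Suc k) (Suc m) = pade_poly a (Suc k) m -
    smult ((a + of_nat (Suc k)) * of_nat (Suc k) / (of_nat (Suc k + m) * of_nat (Suc k + m + 1)))
      (pCons 0 (pade_poly a k m))"
  by (rule poly_eqI, rename_tac n, case_tac n)
     (simp_all add: coeff_pade_poly pade_coeff_Suc_right del: of_nat_Suc of_nat_add)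

lemma pade_poly_Suc_left:
  "pade_poly a (Suc k) (Suc m) = pade_poly a k (Suc m) -
    smult (of_nat (Suc m) * (of_nat (Suc m) - a) / (of_nat (k + Suc m) * of_nat (k + Suc m + 1)))
      (pCons 0 (pade_poly a k m))"
  by (rule poly_eqI, rename_tac n, case_tac n)
     (simp_all add: coeff_pade_poly pade_coeff_Suc_left del: of_nat_Suc of_nat_add)

section \<open>Hypergeometric equation and Wronskian\<close>

text \<open>The term ratio of a terminating hypergeometric series, cleared of denominators; from
  \<open>j = m\<close> on both sides vanish.\<close>

lemma pade_coeff_rec:
  fixes a :: "'a::field_char_0"
  shows "of_nat (Suc j) * (of_nat j - of_nat k - of_nat m) * pade_coeff a k m (Suc j) =
    (of_nat j - of_nat m) * (of_nat j - a - of_nat k) * pade_coeff a k m j"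
proof (cases "j < m")
  case True
  have comb: "J * (- (K + D)) * (C * F / G * W) = - (C * J) * (K + D) * F / G * W"
    for C D F G J K W :: 'a
    by (simp add: divide_inverse algebra_simps)
  from True obtain d where m: "m = Suc (j + d)" using less_iff_Suc_add by auto
  have ch: "of_nat (m choose Suc j) * (of_nat (Suc j) :: 'a) = of_nat (m choose j) * of_nat (Suc d)"
    using choose_Suc_mult[of j m, where 'a = 'a] True by (simp add: m algebra_simps)
  have po: "pochhammer (- a - of_nat k) (Suc j) = (of_nat j - a - of_nat k) * pochhammer (- a - of_nat k) j"
    by (simp add: pochhammer_rec' algebra_simps)
  have f: "fact (k + m - j) = (of_nat k + of_nat (Suc d)) * (fact (k + m - Suc j) :: 'a)"
    by (simp add: m)
  have g: "of_nat j - of_nat k - of_nat m = - (of_nat k + of_nat (Suc d) :: 'a)"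
          "of_nat j - of_nat m = - (of_nat (Suc d) :: 'a)"
    by (simp_all add: m)
  have "of_nat (Suc j) * (of_nat j - of_nat k - of_nat m) * pade_coeff a k m (Suc j)
     = - (of_nat (m choose Suc j) * of_nat (Suc j)) * (of_nat k + of_nat (Suc d)) * fact (k + m - Suc j) / fact (k + m)
       * ((of_nat j - a - of_nat k) * pochhammer (- a - of_nat k) j)"
    unfolding pade_coeff_def po g by (rule comb)
  also have "\<dots> = (of_nat j - of_nat m) * (of_nat j - a - of_nat k) * pade_coeff a k m j"
    unfolding ch unfolding pade_coeff_def f g by (simp del: of_nat_Suc)
  finally show ?thesis .
next
  case False
  thus ?thesis by (cases "j = m") (simp_all add: pade_coeff_def binomial_eq_0)
qed

text \<open>Gauss's equation for the upper parameters \<open>-m\<close>, \<open>-a-k\<close> and the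
  lower parameter \<open>-k-m\<close>. Comparing coefficients of \<open>z^n\<close> gives
  \<open>pade_coeff_rec\<close>.\<close>

lemma pade_poly_ode:
  fixes a :: "'a::field_char_0" and k m :: nat
  defines "Q \<equiv> pade_poly a k m"
  shows "[:0, 1:] * (1 - [:0, 1:]) * pderiv (pderiv Q) -
      (of_nat k + of_nat m + (1 - [:a:] - of_nat k - of_nat m) * [:0, 1:]) * pderiv Q -
      of_nat m * ([:a:] + of_nat k) * Q = 0"
proof -
  have "pCons 0 (pderiv (pderiv Q)) - pCons 0 (pCons 0 (pderiv (pderiv Q)))
      - smult (of_nat k + of_nat m) (pderiv Q)
      - smult (1 - a - of_nat k - of_nat m) (pCons 0 (pderiv Q))
      - smult (of_nat m * (a + of_nat k)) Q = 0" (is "?L = 0")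
  proof (rule poly_eqI)
    fix n
    have eq: "coeff ?L n = of_nat (Suc n) * (of_nat n - of_nat k - of_nat m) * pade_coeff a k m (Suc n)
       - (of_nat n - of_nat m) * (of_nat n - a - of_nat k) * pade_coeff a k m n"
    proof (cases n)
      case 0
      then show ?thesis
        by (simp add: coeff_pderiv coeff_pade_poly Q_def algebra_simps)
    next
      case (Suc n')
      then show ?thesis
        by (cases n') (simp_all add: coeff_pderiv coeff_pade_poly Q_def algebra_simps)
    qed
    show "coeff ?L n = coeff 0 n"
      unfolding eq pade_coeff_rec by simp
  qed
  moreover have "?L = [:0, 1:] * (1 - [:0, 1:]) * pderiv (pderiv Q) -
      (of_nat k + of_nat m + (1 - [:a:] - of_nat k - of_nat m) * [:0, 1:]) * pderiv Q -
      of_nat m * ([:a:] + of_nat k) * Q"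
    by (simp add: algebra_simps of_nat_poly smult_add_left smult_diff_left one_pCons[symmetric])
  ultimately show ?thesis by simp
qed

lemma coeff_mult_top:
  assumes "degree p \<le> i" "degree q \<le> j"
  shows "coeff (p * q) (i + j) = coeff p i * coeff q j"
proof -
  have "coeff (p * q) (i + j) = (\<Sum>n\<le>i+j. coeff p n * coeff q (i + j - n))"
    by (simp add: coeff_mult)
  also have "\<dots> = (\<Sum>n\<in>{i}. coeff p n * coeff q (i + j - n))"
  proof (rule sum.mono_neutral_right)
    show "\<forall>n\<in>{..i+j} - {i}. coeff p n * coeff q (i + j - n) = 0"
    proof
      fix n assume "n \<in> {..i+j} - {i}"
      hence "n > i \<or> i + j - n > j" by auto
      thus "coeff p n * coeff q (i + j - n) = 0"
        using assms by (auto simp: coeff_eq_0)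
    qed
  qed auto
  finally show ?thesis by simp
qed

text \<open>For \<open>R = P/Q\<close> this is \<open>Q^2 (a R - (1 - z) R')\<close>, the defect of
  \<open>R\<close> in the equation that \<open>(1 - z) powr (-a)\<close> solves.\<close>

definition pade_wronskian :: "'a::field_char_0 \<Rightarrow> nat \<Rightarrow> nat \<Rightarrow> 'a poly" where
  "pade_wronskian a k m =
    (let P = pade_poly (- a) m k; Q = pade_poly a k m
     in [:a:] * (P * Q) - (1 - [:0, 1:]) * (pderiv P * Q - P * pderiv Q))"

text \<open>The difference of the two sides is \<open>P\<close> times the equation of
  \<open>Q\<close> minus \<open>Q\<close> times the equation of \<open>P\<close>.\<close>

lemma pade_wronskian_ode:
  "[:0, 1:] * pderiv (pade_wronskian a k m) = of_nat (k + m) * pade_wronskian a k m"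
proof -
  define P Q X A where "P = pade_poly (- a) m k" and "Q = pade_poly a k m" and "X = [:0, 1:: 'a:]" and "A = [:a:]"
  have dX: "pderiv X = 1" and dA: "pderiv A = 0"
    by (simp_all add: X_def A_def pderiv_pCons)
  have E: "pade_wronskian a k m = A * (P * Q) - (1 - X) * (pderiv P * Q - P * pderiv Q)"
    by (simp add: pade_wronskian_def Let_def P_def Q_def X_def A_def)
  have odeQ: "X * (1 - X) * pderiv (pderiv Q) -
      (of_nat k + of_nat m + (1 - A - of_nat k - of_nat m) * X) * pderiv Q - of_nat m * (A + of_nat k) * Q = 0"
    unfolding Q_def X_def A_def by (rule pade_poly_ode)
  have mA: "[:-a:] = - A" by (simp add: A_def)
  have odeP: "X * (1 - X) * pderiv (pderiv P) -
      (of_nat m + of_nat k + (1 - (- A) - of_nat m - of_nat k) * X) * pderiv P - of_nat k * (- A + of_nat m) * P = 0"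
    unfolding P_def X_def mA[symmetric] by (rule pade_poly_ode)
  define P1 P2 Q1 Q2 where "P1 = pderiv P" and "P2 = pderiv P1" and "Q1 = pderiv Q" and "Q2 = pderiv Q1"
  have "X * pderiv (pade_wronskian a k m) - of_nat (k + m) * pade_wronskian a k m =
    P * (X * (1 - X) * Q2 - (of_nat k + of_nat m + (1 - A - of_nat k - of_nat m) * X) * Q1 - of_nat m * (A + of_nat k) * Q)
    - Q * (X * (1 - X) * P2 - (of_nat m + of_nat k + (1 - (- A) - of_nat m - of_nat k) * X) * P1 - of_nat k * (- A + of_nat m) * P)"
    unfolding E pderiv_diff pderiv_mult dX dA pderiv_1
      P1_def[symmetric] P2_def[symmetric] Q1_def[symmetric] Q2_def[symmetric]
    by (simp add: algebra_simps)
  also have "\<dots> = 0"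
    using odeP odeQ unfolding P1_def P2_def Q1_def Q2_def by simp
  finally show ?thesis unfolding X_def by simp
qed

text \<open>The operator \<open>z d/dz\<close> multiplies the coefficient of \<open>z^n\<close> by
  \<open>n\<close>, so only \<open>n = k + m\<close> survives the equation above.\<close>

lemma pade_wronskian_eq_monom:
  "pade_wronskian a k m = monom (coeff (pade_wronskian a k m) (k + m)) (k + m)"
proof (rule poly_eqI)
  fix n
  have "coeff ([:0, 1:] * pderiv (pade_wronskian a k m)) n = of_nat n * coeff (pade_wronskian a k m) n"
    by (cases n) (simp_all add: coeff_pderiv)
  hence "coeff (pade_wronskian a k m) n = 0 \<or> n = k + m"
    unfolding pade_wronskian_ode by (auto simp add: of_nat_poly simp del: of_nat_add)
  thus "coeff (pade_wronskian a k m) n = coeff (monom (coeff (pade_wronskian a k m) (k + m)) (k + m)) n"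
    by auto
qed

text \<open>At the top degree \<open>a P Q\<close>, \<open>z P' Q\<close> and
  \<open>- z P Q'\<close> contribute \<open>a\<close>, \<open>k\<close> and \<open>-m\<close> times
  the product of the top coefficients; \<open>P' Q\<close> and \<open>P Q'\<close> do not reach that
  degree.\<close>

lemma coeff_pade_wronskian:
  "coeff (pade_wronskian a k m) (k + m) =
     fact k * fact m * pochhammer a (k + 1) * pochhammer (1 - a) m / (fact (k + m)) ^ 2"
proof -
  define P Q where "P = pade_poly (- a) m k" and "Q = pade_poly a k m"
  have dP: "degree P \<le> k" and dQ: "degree Q \<le> m"
    by (simp_all add: P_def Q_def degree_pade_poly)
  have dP': "degree (pderiv P) \<le> k" "degree (pCons 0 (pderiv P)) \<le> k"
    and dQ': "degree (pderiv Q) \<le> m" "degree (pCons 0 (pderiv Q)) \<le> m"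
    by (rule degree_le, use dP dQ in \<open>simp add: coeff_pderiv coeff_pCons coeff_eq_0 split: nat.splits\<close>)+
  have c0: "coeff (pderiv P) k = 0" "coeff (pderiv Q) m = 0"
    using dP dQ by (auto simp: coeff_pderiv coeff_eq_0)
  have c1: "coeff (pCons 0 (pderiv P)) k = of_nat k * coeff P k" "coeff (pCons 0 (pderiv Q)) m = of_nat m * coeff Q m"
    by (cases k; simp add: coeff_pderiv) (cases m; simp add: coeff_pderiv)
  have E: "pade_wronskian a k m = smult a (P * Q) - pderiv P * Q + P * pderiv Q
     + pCons 0 (pderiv P) * Q - P * pCons 0 (pderiv Q)"
    by (simp add: pade_wronskian_def Let_def P_def Q_def algebra_simps)
  have "coeff (pade_wronskian a k m) (k + m) = (a + of_nat k - of_nat m) * (coeff P k * coeff Q m)"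
    unfolding E coeff_diff coeff_add coeff_smult
      coeff_mult_top[OF dP dQ] coeff_mult_top[OF dP'(1) dQ] coeff_mult_top[OF dP dQ'(1)]
      coeff_mult_top[OF dP'(2) dQ] coeff_mult_top[OF dP dQ'(2)] c0 c1
    by (simp add: algebra_simps)
  also have cP: "coeff P k = fact m / fact (k + m) * pochhammer (a - of_nat m) k"
    by (simp add: P_def coeff_pade_poly pade_coeff_def add.commute)
  also have cQ: "coeff Q m = fact k / fact (k + m) * pochhammer (- (a + of_nat k)) m"
    by (simp add: Q_def coeff_pade_poly pade_coeff_def)
  also have "(a + of_nat k - of_nat m) * (fact m / fact (k + m) * pochhammer (a - of_nat m) k *
        (fact k / fact (k + m) * pochhammer (- (a + of_nat k)) m)) = fact k * fact m / (fact (k + m))^2 *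
      ((a - of_nat m + of_nat k) * pochhammer (a - of_nat m) k * pochhammer (- (a + of_nat k)) m)"
    unfolding cP cQ by (simp add: power2_eq_square divide_inverse algebra_simps)
  also have "(a - of_nat m + of_nat k) * pochhammer (a - of_nat m) k = pochhammer (a - of_nat m) (k + 1)"
    by (simp add: pochhammer_rec')
  also have "pochhammer (- (a + of_nat k)) m = (- 1) ^ m * pochhammer (a - of_nat m + of_nat (k + 1)) m"
    unfolding pochhammer_minus by (simp add: algebra_simps)
  also have "pochhammer (a - of_nat m) (k + 1) * ((- 1) ^ m * pochhammer (a - of_nat m + of_nat (k + 1)) m)
     = (-1) ^ m * pochhammer (a - of_nat m) ((k + 1) + m)"
    by (subst pochhammer_product') simp
  \<comment> \<open>The merged symbol \<open>(a-m)_(k+m+1)\<close> is now split after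
    \<open>m\<close> factors, where its argument reaches \<open>a\<close>.\<close>
  also have "(k + 1) + m = m + (k + 1)" by simp
  also have "pochhammer (a - of_nat m) (m + (k + 1)) = pochhammer (a - of_nat m) m * pochhammer a (k + 1)"
    by (subst pochhammer_product') simp
  also have "pochhammer (a - of_nat m) m = (-1) ^ m * pochhammer (1 - a) m"
    using pochhammer_minus[of "of_nat m - a" m] by (simp add: algebra_simps)
  also have "(-1) ^ m * ((-1) ^ m * pochhammer (1 - a) m * pochhammer a (k + 1)) = pochhammer a (k + 1) * pochhammer (1 - a) m"
    by (simp add: mult.assoc[symmetric] power_mult_distrib[symmetric])
  finally show ?thesis by (simp add: mult_ac)
qed

section \<open>Nonnegativity along staircases\<close>

definition fps_nonneg :: "complex fps \<Rightarrow> bool" where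
  "fps_nonneg f \<longleftrightarrow> (\<forall>n. fps_nth f n \<in> \<real>\<^sub>\<ge>\<^sub>0)"

lemma nonneg_Reals_sum: "(\<And>i. i \<in> A \<Longrightarrow> f i \<in> \<real>\<^sub>\<ge>\<^sub>0) \<Longrightarrow> (\<Sum>i\<in>A. f i :: complex) \<in> \<real>\<^sub>\<ge>\<^sub>0"
  by (induction A rule: infinite_finite_induct) auto

lemma fps_nonneg_1 [simp]: "fps_nonneg 1"
  by (simp add: fps_nonneg_def)

lemma fps_nonneg_X [simp]: "fps_nonneg fps_X"
  by (simp add: fps_nonneg_def fps_X_def)

lemma fps_nonneg_const [simp]: "fps_nonneg (fps_const c) \<longleftrightarrow> c \<in> \<real>\<^sub>\<ge>\<^sub>0"
  by (auto simp: fps_nonneg_def)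

lemma fps_nonneg_add: "fps_nonneg f \<Longrightarrow> fps_nonneg g \<Longrightarrow> fps_nonneg (f + g)"
  by (simp add: fps_nonneg_def)

lemma fps_nonneg_mult: "fps_nonneg f \<Longrightarrow> fps_nonneg g \<Longrightarrow> fps_nonneg (f * g)"
  by (simp add: fps_nonneg_def fps_mult_nth nonneg_Reals_sum)

lemma fps_nonneg_power: "fps_nonneg f \<Longrightarrow> fps_nonneg (f ^ n)"
  by (induction n) (auto intro: fps_nonneg_mult)

text \<open>The inverse solves \<open>v = 1 + g v\<close>. Since \<open>g\<close> has no constant
  term, each coefficient of \<open>g v\<close> involves only earlier coefficients of
  \<open>v\<close>.\<close>

lemma fps_nonneg_inverse_one_minus:
  assumes "fps_nonneg g" "fps_nth g 0 = 0"
  shows "fps_nonneg (inverse (1 - g))"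
proof -
  define v where "v = inverse (1 - g)"
  have "v * (1 - g) = 1"
    unfolding v_def using assms(2) by (intro inverse_mult_eq_1) simp
  hence v: "v = 1 + g * v" by (simp add: algebra_simps)
  have "fps_nth v n \<in> \<real>\<^sub>\<ge>\<^sub>0" for n
  proof (induction n rule: less_induct)
    case (less n)
    have "fps_nth (g * v) n \<in> \<real>\<^sub>\<ge>\<^sub>0"
      unfolding fps_mult_nth
    proof (rule nonneg_Reals_sum)
      fix i assume "i \<in> {0..n}"
      thus "fps_nth g i * fps_nth v (n - i) \<in> \<real>\<^sub>\<ge>\<^sub>0"
        using assms less by (cases "i = 0") (auto simp: fps_nonneg_def)
    qed
    moreover have "fps_nth v n = fps_nth 1 n + fps_nth (g * v) n"
      by (subst v) simp
    ultimately show ?case by simp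
  qed
  thus ?thesis by (simp add: fps_nonneg_def v_def)
qed

text \<open>
  The invariant of two consecutive approximants \<open>P\<^sub>0/Q\<^sub>0\<close>, \<open>P\<^sub>1/Q\<^sub>1\<close> of a staircase. The bounds \<open>r\<close>
  that are used below are the values of \<open>Q\<^sub>1/Q\<^sub>0\<close> at \<open>z = 1\<close>.
\<close>

definition pade_step :: "real \<Rightarrow> complex poly \<Rightarrow> complex poly \<Rightarrow> complex poly \<Rightarrow> complex poly \<Rightarrow> bool" where
  "pade_step r P0 Q0 P1 Q1 \<longleftrightarrow>
     r > 0 \<and> coeff Q0 0 = 1 \<and> coeff Q1 0 = 1 \<and>
     fps_nonneg (fps_of_poly Q0 * inverse (fps_of_poly Q1)) \<and>
     fps_nonneg (inverse (fps_of_poly Q1)) \<and>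
     fps_nonneg (fps_of_poly P1 * inverse (fps_of_poly Q1)) \<and>
     fps_nonneg (fps_of_poly (P1 * Q0 - P0 * Q1)) \<and>
     (\<forall>z. norm z \<le> 1 \<longrightarrow> poly Q0 z \<noteq> 0 \<and> r * norm (poly Q0 z) \<le> norm (poly Q1 z))"

lemma pade_step_next:
  assumes step: "pade_step r P0 Q0 P1 Q1"
    and Q2: "Q2 = Q1 - smult (of_real b) (pCons 0 Q0)"
    and P2: "P2 = P1 - smult (of_real b) (pCons 0 P0)"
    and b: "b \<ge> 0" and r': "r' = 1 - b / r" "r' > 0"
  shows "pade_step r' P1 Q1 P2 Q2"
proof -
  have r: "r > 0" and c0: "coeff Q0 0 = 1" and c1: "coeff Q1 0 = 1"
    and n01: "fps_nonneg (fps_of_poly Q0 * inverse (fps_of_poly Q1))"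
    and n1: "fps_nonneg (inverse (fps_of_poly Q1))"
    and u1: "fps_nonneg (fps_of_poly P1 * inverse (fps_of_poly Q1))"
    and d: "fps_nonneg (fps_of_poly (P1 * Q0 - P0 * Q1))"
    and nz: "\<And>z. norm z \<le> 1 \<Longrightarrow> poly Q0 z \<noteq> 0"
    and le: "\<And>z. norm z \<le> 1 \<Longrightarrow> r * norm (poly Q0 z) \<le> norm (poly Q1 z)"
    using step unfolding pade_step_def by auto
  define q0 q1 q2 p1 p2 where "q0 = fps_of_poly Q0" and "q1 = fps_of_poly Q1"
    and "q2 = fps_of_poly Q2" and "p1 = fps_of_poly P1" and "p2 = fps_of_poly P2"
  define B where "B = fps_const (complex_of_real b) * fps_X"
  have B: "fps_nonneg B" using b by (simp add: B_def fps_nonneg_mult)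
  have pX: "fps_of_poly (smult (of_real b) (pCons 0 p)) = B * fps_of_poly p" for p
    by (simp add: B_def fps_of_poly_smult fps_of_poly_pCons mult_ac)
  have q2: "q2 = q1 - B * q0"
    unfolding q0_def q1_def q2_def Q2 fps_of_poly_diff pX ..
  have c2: "coeff Q2 0 = 1" by (simp add: Q2 c1)
  have u: "fps_nth q1 0 = 1" "fps_nth q2 0 = 1"
    using c1 c2 by (simp_all add: q1_def q2_def)
  have i1: "inverse q1 * q1 = 1" and i2: "inverse q2 * q2 = 1"
    using u by (simp_all add: inverse_mult_eq_1)
  have "q1 * inverse q2 = inverse (q2 * inverse q1)"
    using u by (simp add: fps_inverse_mult mult.commute)
  also have "q2 * inverse q1 = 1 - B * (q0 * inverse q1)"
    using i1 by (simp add: q2 algebra_simps)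
  also have "fps_nonneg (inverse (1 - B * (q0 * inverse q1)))"
    using n01 by (intro fps_nonneg_inverse_one_minus fps_nonneg_mult[OF B]) (simp_all add: q0_def q1_def B_def)
  finally have n12: "fps_nonneg (q1 * inverse q2)" .
  have "fps_nonneg (inverse q1 * (q1 * inverse q2))"
    by (rule fps_nonneg_mult[OF n1[folded q1_def] n12])
  hence n2: "fps_nonneg (inverse q2)"
    by (simp only: mult.assoc[symmetric] i1 mult_1_left)
  \<comment> \<open>The products \<open>P1 * Q1\<close> cancel, so the cross difference only picks
    up the factor \<open>b z\<close>.\<close>
  have "P2 * Q1 - P1 * Q2 = smult (of_real b) (pCons 0 (P1 * Q0 - P0 * Q1))"
    by (simp add: P2 Q2 algebra_simps smult_diff_right)
  hence "fps_of_poly (P2 * Q1 - P1 * Q2) = B * fps_of_poly (P1 * Q0 - P0 * Q1)"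
    by (simp only: pX)
  hence d2: "fps_nonneg (fps_of_poly (P2 * Q1 - P1 * Q2))"
    using d B by (simp only: fps_nonneg_mult)
  \<comment> \<open>The new approximant is the old one plus the cross difference over
    \<open>q1 * q2\<close>, a sum of nonnegative series.\<close>
  have "p2 * inverse q2 = p1 * inverse q1 + (p2 * q1 - p1 * q2) * inverse q1 * inverse q2"
  proof -
    have "(p2 * q1 - p1 * q2) * inverse q1 * inverse q2 =
        p2 * inverse q2 * (inverse q1 * q1) - p1 * inverse q1 * (inverse q2 * q2)"
      by (simp add: algebra_simps)
    thus ?thesis by (simp add: i1 i2)
  qed
  moreover have "fps_nonneg (p2 * q1 - p1 * q2)"
    using d2 by (simp add: p1_def p2_def q1_def q2_def fps_of_poly_diff fps_of_poly_mult)
  ultimately have u2: "fps_nonneg (p2 * inverse q2)"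
    using u1 n1 n2 by (simp add: fps_nonneg_add fps_nonneg_mult p1_def q1_def)
  have "poly Q1 z \<noteq> 0 \<and> r' * norm (poly Q1 z) \<le> norm (poly Q2 z)" if z: "norm z \<le> 1" for z
  proof
    have pos: "0 < r * norm (poly Q0 z)" using r nz[OF z] by simp
    with le[OF z] show "poly Q1 z \<noteq> 0" by auto
    \<comment> \<open>The subtracted term is at most \<open>b / r\<close> times \<open>Q1\<close>,
      which leaves the fraction \<open>r' = 1 - b / r\<close>.\<close>
    have "norm (of_real b * (z * poly Q0 z)) = b * (norm z * norm (poly Q0 z))"
      using b by (simp add: norm_mult)
    also have "\<dots> \<le> b * norm (poly Q0 z)"
      using b z by (intro mult_left_mono mult_left_le_one_le) auto
    also have "\<dots> \<le> b * (norm (poly Q1 z) / r)"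
      using b r le[OF z] by (intro mult_left_mono) (auto simp: field_simps)
    finally have *: "norm (of_real b * (z * poly Q0 z)) \<le> b / r * norm (poly Q1 z)" by simp
    have Q2z: "poly Q2 z = poly Q1 z - of_real b * (z * poly Q0 z)"
      by (simp add: Q2)
    have "norm (poly Q1 z) - b / r * norm (poly Q1 z) \<le> norm (poly Q2 z)"
      using * norm_triangle_ineq2[of "poly Q1 z" "of_real b * (z * poly Q0 z)"] unfolding Q2z by linarith
    thus "r' * norm (poly Q1 z) \<le> norm (poly Q2 z)"
      by (simp add: r' left_diff_distrib)
  qed
  thus ?thesis
    unfolding pade_step_def using r' c1 c2 n12 n2 u2 d2
    by (simp add: q1_def q2_def p2_def)
qed

text \<open>In the column \<open>m = 0\<close> the numerators are the Taylor polynomials of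
  \<open>(1 - z) powr (-a)\<close>.\<close>

lemma pade_coeff_0_left:
  "pade_coeff (- a) 0 k j = (if j \<le> k then pochhammer a j / fact j else 0)"
  by (simp add: pade_coeff_def binomial_fact field_simps)

section \<open>Explicit staircase steps for \<open>0 < a < 1\<close>\<close>

context
  fixes a :: real
  assumes a: "0 < a" "a < 1"
begin

lemma pade_step_Suc_left:
  assumes "pade_step ((real k + 1) / (real k + real m + 1))
      (pade_poly (- of_real a) m k) (pade_poly (of_real a) k m)
      (pade_poly (- of_real a) m (Suc k)) (pade_poly (of_real a) (Suc k) m)"
  shows "pade_step ((1 - a + real m) / (real (Suc k) + real m + 1))
      (pade_poly (- of_real a) m (Suc k)) (pade_poly (of_real a) (Suc k) m)
      (pade_poly (- of_real a) (Suc m) (Suc k)) (pade_poly (of_real a) (Suc k) (Suc m))"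
proof (rule pade_step_next[OF assms, where b = "(a + real (Suc k)) * real (Suc k) / (real (Suc k + m) * real (Suc k + m + 1))"])
  show "pade_poly (of_real a) (Suc k) (Suc m) = pade_poly (of_real a) (Suc k) m -
      smult (of_real ((a + real (Suc k)) * real (Suc k) / (real (Suc k + m) * real (Suc k + m + 1))))
       (pCons 0 (pade_poly (complex_of_real a) k m))"
    by (subst pade_poly_Suc_right) simp
  show "pade_poly (- of_real a) (Suc m) (Suc k) = pade_poly (- of_real a) m (Suc k) -
      smult (of_real ((a + real (Suc k)) * real (Suc k) / (real (Suc k + m) * real (Suc k + m + 1))))
       (pCons 0 (pade_poly (- complex_of_real a) m k))"
    by (subst pade_poly_Suc_left) (simp add: add_ac mult_ac)
  define K M where "K = real k" and "M = real m"
  have "K \<ge> 0" "M \<ge> 0" by (simp_all add: K_def M_def)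
  hence nz: "K + M + 1 \<noteq> 0" "K + 1 \<noteq> 0" "K + M + 2 \<noteq> 0" by linarith+
  \<comment> \<open>Here \<open>b / r = (a + K + 1) / (K + M + 2)\<close>; the new bound is positive
    because \<open>a < 1\<close>.\<close>
  have "(1 - a + M) / (K + M + 2) = 1 - (a + (K + 1)) * (K + 1) / ((K + M + 1) * (K + M + 2)) / ((K + 1) / (K + M + 1))"
    using nz by (simp add: divide_simps)
  thus "(1 - a + real m) / (real (Suc k) + real m + 1) =
    1 - (a + real (Suc k)) * real (Suc k) / (real (Suc k + m) * real (Suc k + m + 1)) / ((real k + 1) / (real k + real m + 1))"
    by (simp add: K_def M_def add_ac)
qed (use a in \<open>auto intro!: divide_pos_pos\<close>)

lemma pade_step_Suc_right:
  assumes "pade_step ((1 - a + real m) / (real k + real m + 1))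
      (pade_poly (- of_real a) m k) (pade_poly (of_real a) k m)
      (pade_poly (- of_real a) (Suc m) k) (pade_poly (of_real a) k (Suc m))"
  shows "pade_step ((real k + 1) / (real k + real (Suc m) + 1))
      (pade_poly (- of_real a) (Suc m) k) (pade_poly (of_real a) k (Suc m))
      (pade_poly (- of_real a) (Suc m) (Suc k)) (pade_poly (of_real a) (Suc k) (Suc m))"
proof (rule pade_step_next[OF assms, where b = "real (Suc m) * (real (Suc m) - a) / (real (k + Suc m) * real (k + Suc m + 1))"])
  show "pade_poly (of_real a) (Suc k) (Suc m) = pade_poly (of_real a) k (Suc m) -
      smult (of_real (real (Suc m) * (real (Suc m) - a) / (real (k + Suc m) * real (k + Suc m + 1))))
       (pCons 0 (pade_poly (complex_of_real a) k m))"
    by (subst pade_poly_Suc_left) simp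
  show "pade_poly (- of_real a) (Suc m) (Suc k) = pade_poly (- of_real a) (Suc m) k -
      smult (of_real (real (Suc m) * (real (Suc m) - a) / (real (k + Suc m) * real (k + Suc m + 1))))
       (pCons 0 (pade_poly (- complex_of_real a) m k))"
    by (subst pade_poly_Suc_right) (simp add: add_ac mult_ac add_diff_eq)
  define K M where "K = real k" and "M = real m"
  have "K \<ge> 0" "M \<ge> 0" by (simp_all add: K_def M_def)
  hence nz: "K + M + 1 \<noteq> 0" "M + 1 - a \<noteq> 0" "K + M + 2 \<noteq> 0" using a by linarith+
  \<comment> \<open>Here \<open>b / r = (M + 1) / (K + M + 2)\<close>, in which \<open>a\<close> has
    cancelled.\<close>
  have "(K + 1) / (K + M + 2) = 1 - (M + 1) * (M + 1 - a) / ((K + M + 1) * (K + M + 2)) / ((M + 1 - a) / (K + M + 1))"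
    using nz by (simp add: divide_simps)
  thus "(real k + 1) / (real k + real (Suc m) + 1) =
    1 - real (Suc m) * (real (Suc m) - a) / (real (k + Suc m) * real (k + Suc m + 1)) / ((1 - a + real m) / (real k + real m + 1))"
    by (simp add: K_def M_def algebra_simps)
qed (use a in \<open>auto intro!: divide_pos_pos\<close>)

lemma pade_coeff_0_left_nonneg: "pade_coeff (- complex_of_real a) 0 k j \<in> \<real>\<^sub>\<ge>\<^sub>0"
proof -
  have eq: "pochhammer (complex_of_real a) j / fact j = of_real (pochhammer a j / fact j)"
    by (simp add: pochhammer_of_real)
  have "pochhammer a j \<ge> 0" using a by (intro pochhammer_nonneg) auto
  hence "pochhammer (complex_of_real a) j / fact j \<in> \<real>\<^sub>\<ge>\<^sub>0"
    unfolding eq nonneg_Reals_of_real_iff by simp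
  thus ?thesis by (simp add: pade_coeff_0_left)
qed

text \<open>Both denominators are \<open>1\<close>, and the numerators differ by a single Taylor
  term, which is nonnegative.\<close>

lemma pade_step_base:
  "pade_step ((real k + 1) / (real k + real 0 + 1))
      (pade_poly (- of_real a) 0 k) (pade_poly (of_real a) k 0)
      (pade_poly (- of_real a) 0 (Suc k)) (pade_poly (of_real a) (Suc k) 0)"
proof -
  have "coeff (pade_poly (- complex_of_real a) 0 (Suc k) - pade_poly (- complex_of_real a) 0 k) n \<in> \<real>\<^sub>\<ge>\<^sub>0" for n
    using pade_coeff_0_left_nonneg[of "Suc k" n]
    by (auto simp: coeff_pade_poly pade_coeff_0_left)
  thus ?thesis
    using pade_coeff_0_left_nonneg
    by (simp add: pade_step_def pade_poly_0_right fps_nonneg_def coeff_pade_poly)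
qed

lemma pade_step_base_0_0:
  "pade_step ((1 - a + real 0) / (real 0 + real 0 + 1))
      (pade_poly (- of_real a) 0 0) (pade_poly (of_real a) 0 0)
      (pade_poly (- of_real a) (Suc 0) 0) (pade_poly (of_real a) 0 (Suc 0))"
proof -
  \<comment> \<open>one step from the fictitious approximant \<open>0/1\<close> in front of \<open>[0/0] = 1/1\<close>\<close>
  have "pade_step (1 - a) 1 1 1 (1 - smult (of_real a) (pCons 0 1))"
  proof (rule pade_step_next[where ?P0.0 = 0 and ?Q0.0 = 1 and b = a and r = 1])
    show "pade_step 1 0 1 1 1"
      by (simp add: pade_step_def)
  qed (use a in auto)
  moreover have "pade_poly (complex_of_real a) 0 (Suc 0) = 1 - smult (of_real a) (pCons 0 1)"
    by (simp add: pade_poly_def pade_coeff_def monom_Suc monom_0 one_pCons)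
  ultimately show ?thesis
    by (simp add: pade_poly_0_right)
qed

text \<open>The two kinds of step alternate: a step in \<open>k\<close> in column
  \<open>m + 1\<close> follows a step in \<open>m\<close> from column \<open>m\<close> at the same
  \<open>k\<close>, and a step in \<open>m\<close> at \<open>k + 1\<close> follows the step in
  \<open>k\<close> that leads there. This keeps within \<open>m \<le> k + 1\<close>.\<close>

lemma pade_step_staircase:
  shows "m \<le> Suc k \<Longrightarrow> pade_step ((real k + 1) / (real k + real m + 1))
      (pade_poly (- of_real a) m k) (pade_poly (of_real a) k m)
      (pade_poly (- of_real a) m (Suc k)) (pade_poly (of_real a) (Suc k) m)"
    and "m \<le> k \<Longrightarrow> pade_step ((1 - a + real m) / (real k + real m + 1))
      (pade_poly (- of_real a) m k) (pade_poly (of_real a) k m)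
      (pade_poly (- of_real a) (Suc m) k) (pade_poly (of_real a) k (Suc m))"
proof (induction m arbitrary: k)
  case 0
  {
    case 1
    show ?case by (rule pade_step_base)
  next
    case 2
    \<comment> \<open>At \<open>k = 0\<close> there is no preceding step in \<open>k\<close>, hence
      the separate start \<open>pade_step_base_0_0\<close>.\<close>
    show ?case
      by (cases k) (simp_all only: pade_step_base_0_0 pade_step_Suc_left[OF pade_step_base])
  }
next
  case (Suc m)
  have left: "pade_step ((real k + 1) / (real k + real (Suc m) + 1))
      (pade_poly (- of_real a) (Suc m) k) (pade_poly (of_real a) k (Suc m))
      (pade_poly (- of_real a) (Suc m) (Suc k)) (pade_poly (of_real a) (Suc k) (Suc m))"
    if "Suc m \<le> Suc k" for k
    using that by (intro pade_step_Suc_right Suc.IH) simp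
  {
    case 1
    thus ?case by (rule left)
  next
    case 2
    then obtain k' where k: "k = Suc k'" by (cases k) auto
    show ?case unfolding k using 2 by (intro pade_step_Suc_left left) (simp add: k)
  }
qed

text \<open>Each admissible pair is the end of a step: from \<open>(k, k)\<close> if
  \<open>m = k + 1\<close>, otherwise from \<open>(k - 1, m)\<close>. Only \<open>(0, 0)\<close> has
  no predecessor, which \<open>k + m \<ge> 1\<close> excludes.\<close>

lemma pade_nonneg:
  assumes "m \<le> Suc k" "k + m \<ge> 1"
  shows "fps_nonneg (inverse (fps_of_poly (pade_poly (of_real a) k m)))"
    and "fps_nonneg (fps_of_poly (pade_poly (- of_real a) m k) * inverse (fps_of_poly (pade_poly (of_real a) k m)))"
    and "norm z \<le> 1 \<Longrightarrow> poly (pade_poly (complex_of_real a) k m) z \<noteq> 0"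
proof -
  have "\<exists>r P0 Q0. pade_step r P0 Q0 (pade_poly (- of_real a) m k) (pade_poly (of_real a) k m)"
  proof (cases "m = Suc k")
    case True
    thus ?thesis using pade_step_staircase(2)[of k k] by blast
  next
    case False
    with assms obtain k' where "k = Suc k'" by (cases k) auto
    thus ?thesis using pade_step_staircase(1)[of m k'] False assms by auto
  qed
  then obtain r P0 Q0 where "pade_step r P0 Q0 (pade_poly (- of_real a) m k) (pade_poly (of_real a) k m)"
    by blast
  note step = this[unfolded pade_step_def]
  show "fps_nonneg (inverse (fps_of_poly (pade_poly (of_real a) k m)))"
    and "fps_nonneg (fps_of_poly (pade_poly (- of_real a) m k) * inverse (fps_of_poly (pade_poly (of_real a) k m)))"
    using step by auto
  assume z: "norm z \<le> 1"
  with step have "0 < r * norm (poly Q0 z)" "r * norm (poly Q0 z) \<le> norm (poly (pade_poly (complex_of_real a) k m) z)"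
    by auto
  thus "poly (pade_poly (complex_of_real a) k m) z \<noteq> 0" by auto
qed

end

section \<open>Power series with nonnegative coefficients on the unit disc\<close>

lemma eval_fps_nonneg:
  assumes "fps_nonneg f" "0 \<le> t" "ereal t < fps_conv_radius f"
  shows "eval_fps f (of_real t) \<in> \<real>\<^sub>\<ge>\<^sub>0"
proof -
  have *: "(\<lambda>n. fps_nth f n * of_real t ^ n) sums eval_fps f (of_real t)"
    using assms by (intro sums_eval_fps) simp
  have nn: "fps_nth f n * of_real t ^ n \<in> \<real>\<^sub>\<ge>\<^sub>0" for n
    using assms by (intro nonneg_Reals_mult_I nonneg_Reals_pow_I) (auto simp: fps_nonneg_def)
  have "0 \<le> Re (eval_fps f (of_real t))"
    using sums_Re[OF *] nn by (rule_tac sums_le[OF _ sums_zero]) (auto simp: complex_nonneg_Reals_iff)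
  moreover have im: "Im (fps_nth f n * of_real t ^ n) = 0" for n
    using nn[of n] by (simp add: complex_nonneg_Reals_iff)
  have "Im (eval_fps f (of_real t)) = 0"
    using sums_unique2[OF sums_Im[OF *, unfolded im] sums_zero] .
  ultimately show ?thesis by (simp add: complex_nonneg_Reals_iff)
qed

lemma norm_eval_fps_le:
  fixes F :: "complex fps"
  assumes nonneg: "fps_nonneg F" and rad: "fps_conv_radius F \<ge> 1"
    and zero: "\<And>n. n < N \<Longrightarrow> fps_nth F n = 0" and lead: "fps_nth F N = of_real \<alpha>"
    and le1: "\<And>t. 0 < t \<Longrightarrow> t < 1 \<Longrightarrow> Re (eval_fps F (of_real t)) \<le> 1"
    and z: "norm z < 1"
  shows "norm (eval_fps F z) \<le> norm z ^ N * (\<alpha> + (1 - \<alpha>) * norm z)"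
proof -
  define c where "c n = Re (fps_nth F n)" for n
  have c: "fps_nth F n = of_real (c n)" "c n \<ge> 0" for n
    using nonneg by (auto simp: fps_nonneg_def complex_nonneg_Reals_iff c_def complex_eq_iff)
  have rad': "ereal (norm w) < fps_conv_radius F" if "norm w < 1" for w :: complex
    using that by (intro less_le_trans[OF _ rad]) (simp add: one_ereal_def)
  have part: "(\<Sum>n<M. c n * t ^ n) \<le> 1" if t: "0 < t" "t < 1" for t M
  proof -
    have "(\<lambda>n. fps_nth F n * of_real t ^ n) sums eval_fps F (of_real t)"
      using t by (intro sums_eval_fps rad') simp
    from sums_Re[OF this] have s: "(\<lambda>n. c n * t ^ n) sums Re (eval_fps F (of_real t))"
      by (simp add: c flip: of_real_power)
    have "(\<Sum>n<M. c n * t ^ n) \<le> (\<Sum>n. c n * t ^ n)"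
      using c t by (intro sum_le_suminf sums_summable[OF s]) auto
    also have "\<dots> \<le> 1" using le1[OF t] sums_unique[OF s] by simp
    finally show ?thesis .
  qed
  have sum1: "(\<Sum>n<M. c n) \<le> 1" for M
  \<comment> \<open>Finite partial sums are polynomials in \<open>t\<close>, so the bound on
    \<open>(0, 1)\<close> passes to the limit \<open>t = 1\<close>.\<close>
  proof (rule tendsto_upperbound)
    have "((\<lambda>t. \<Sum>n<M. c n * t ^ n) \<longlongrightarrow> (\<Sum>n<M. c n * 1 ^ n)) (at_left 1)"
      by (intro tendsto_intros)
    thus "((\<lambda>t. \<Sum>n<M. c n * t ^ n) \<longlongrightarrow> (\<Sum>n<M. c n)) (at_left 1)" by simp
    have "eventually (\<lambda>t::real. t \<in> {0<..<1}) (at_left 1)"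
      by (rule eventually_at_leftI[of 0]) auto
    thus "eventually (\<lambda>t. (\<Sum>n<M. c n * t ^ n) \<le> 1) (at_left 1)"
      by eventually_elim (use part in auto)
  qed simp
  define t where "t = norm z"
  have t: "0 \<le> t" "t < 1" using z by (auto simp: t_def)
  have \<alpha>: "c N = \<alpha>" by (simp add: c_def lead)
  have bound: "(\<Sum>n<M. c n * t ^ n) \<le> t ^ N * (\<alpha> + (1 - \<alpha>) * t)" for M
  proof -
    \<comment> \<open>Only the index \<open>N\<close> has a power above \<open>t ^ (N + 1)\<close>
      and a possibly nonzero coefficient; the conditional term restores its excess.\<close>
    have "c n * t ^ n \<le> t ^ (N + 1) * c n + (if n = N then \<alpha> * (t ^ N - t ^ (N + 1)) else 0)" for n
    proof (cases n N rule: linorder_cases)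
      case less
      thus ?thesis by (simp add: c_def zero)
    next
      case equal
      thus ?thesis by (simp add: \<alpha> algebra_simps)
    next
      case greater
      hence "t ^ n \<le> t ^ (N + 1)" using t by (intro power_decreasing) auto
      hence "c n * t ^ n \<le> c n * t ^ (N + 1)" using c(2) by (rule mult_left_mono)
      thus ?thesis using greater by (simp add: mult.commute)
    qed
    hence "(\<Sum>n<M. c n * t ^ n) \<le> (\<Sum>n<M. t ^ (N + 1) * c n + (if n = N then \<alpha> * (t ^ N - t ^ (N + 1)) else 0))"
      by (rule sum_mono)
    also have "\<dots> = t ^ (N + 1) * (\<Sum>n<M. c n) + (if N < M then \<alpha> * (t ^ N - t ^ (N + 1)) else 0)"
      by (simp add: sum.distrib sum_distrib_left)
    also have "\<dots> \<le> t ^ (N + 1) * 1 + \<alpha> * (t ^ N - t ^ (N + 1))"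
    proof (intro add_mono mult_left_mono sum1)
      have "0 \<le> \<alpha> * (t ^ N - t ^ (N + 1))"
        using t c(2)[of N] \<alpha> power_decreasing[of N "N + 1" t] by (intro mult_nonneg_nonneg) auto
      thus "(if N < M then \<alpha> * (t ^ N - t ^ (N + 1)) else 0) \<le> \<alpha> * (t ^ N - t ^ (N + 1))" by simp
    qed (use t in auto)
    also have "\<dots> = t ^ N * (\<alpha> + (1 - \<alpha>) * t)" by (simp add: algebra_simps)
    finally show ?thesis .
  qed
  have nrm: "norm (fps_nth F n * z ^ n) = c n * t ^ n" for n
    using c(2)[of n] by (simp add: c(1) norm_mult norm_power t_def)
  have summ: "summable (\<lambda>n. norm (fps_nth F n * z ^ n))"
    by (intro norm_summable_fps rad' z)
  have "norm (eval_fps F z) \<le> (\<Sum>n. norm (fps_nth F n * z ^ n))"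
    unfolding eval_fps_def by (rule summable_norm[OF summ])
  also have "\<dots> = (\<Sum>n. c n * t ^ n)" by (simp only: nrm)
  also have "\<dots> \<le> t ^ N * (\<alpha> + (1 - \<alpha>) * t)"
    using summ bound unfolding nrm by (intro suminf_le_const) auto
  finally show ?thesis by (simp add: t_def)
qed

section \<open>The constant \<open>\<alpha>\<close>\<close>

lemma pochhammer_mono:
  assumes "0 \<le> x" "x \<le> (y::real)"
  shows "pochhammer x n \<le> pochhammer y n"
  unfolding pochhammer_prod using assms by (intro prod_mono) auto

lemma pochhammer_strict_mono:
  assumes "0 \<le> x" "x < (y::real)" "n > 0"
  shows "pochhammer x n < pochhammer y n"
proof -
  obtain n' where n: "n = Suc n'" using assms by (cases n) auto
  have "pochhammer x n' * (x + real n') \<le> pochhammer y n' * (x + real n')"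
    using assms by (intro mult_right_mono pochhammer_mono) auto
  also have "\<dots> < pochhammer y n' * (y + real n')"
    using assms by (intro mult_strict_left_mono pochhammer_pos) auto
  finally show ?thesis by (simp add: n pochhammer_Suc)
qed

text \<open>The right side is \<open>p\<close> times the Wronskian coefficient for
  \<open>a = 1/p\<close>, the leading coefficient of the derivative of the residual; integration
  divides it by \<open>k + m + 1\<close>.\<close>

lemma pade_alpha_mult:
  "pade_alpha p k m * real (k + m + 1) = real p * (fact k * fact m *
     pochhammer (1 / real p) (k + 1) * pochhammer (1 - 1 / real p) m / (fact (k + m)) ^ 2)"
proof -
  have "(fact (k + m + 1) :: real) = real (k + m + 1) * fact (k + m)" by simp
  thus ?thesis
    unfolding pade_alpha_def by (simp add: power2_eq_square mult_ac del: fact_Suc of_nat_add of_nat_Suc)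
qed

lemma pade_alpha_nonneg: "p \<ge> 2 \<Longrightarrow> pade_alpha p k m \<ge> 0"
  unfolding pade_alpha_def by (intro divide_nonneg_nonneg mult_nonneg_nonneg pochhammer_nonneg) auto

text \<open>The factor \<open>p\<close> cancels the first factor of
  \<open>pochhammer (1 / p) (k + 1)\<close>. Raising \<open>a + 1\<close> to \<open>2\<close> and
  \<open>1 - a\<close> to \<open>1\<close> turns the other symbols into factorials, strictly for at
  least one of them as \<open>k + m \<ge> 1\<close>.\<close>

lemma pade_alpha_less_1:
  assumes "p \<ge> 2" "k + m \<ge> 1"
  shows "pade_alpha p k m < 1"
proof -
  define a where "a = 1 / real p"
  have a: "0 < a" "a < 1" "real p * a = 1" using assms by (auto simp: a_def)
  have two: "pochhammer 2 k = (fact (k + 1) :: real)"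
    using pochhammer_rec[of "1::real" k] by (simp add: pochhammer_fact[symmetric] del: fact_Suc)
  have one: "pochhammer 1 m = (fact m :: real)"
    by (simp add: pochhammer_fact)
  have lt: "pochhammer (a + 1) k * pochhammer (1 - a) m < fact (k + 1) * fact m"
  proof (cases "k = 0")
    case True
    hence "pochhammer (1 - a) m < pochhammer 1 m" using assms a by (intro pochhammer_strict_mono) auto
    thus ?thesis by (simp add: True one)
  next
    case False
    have "pochhammer (a + 1) k * pochhammer (1 - a) m \<le> pochhammer (a + 1) k * pochhammer 1 m"
      using a by (intro mult_left_mono pochhammer_mono pochhammer_nonneg) auto
    also have "\<dots> < pochhammer 2 k * pochhammer 1 m"
      using a False by (intro mult_strict_right_mono pochhammer_strict_mono pochhammer_pos) auto
    finally show ?thesis unfolding one two .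
  qed
  have f: "fact i * fact j \<le> (fact (i + j) :: real)" for i j
  proof -
    have "fact i * fact j \<le> (fact (i + j) :: nat)"
      by (rule dvd_imp_le[OF fact_fact_dvd_fact]) simp
    hence "of_nat (fact i * fact j) \<le> (of_nat (fact (i + j)) :: real)" by (rule of_nat_mono)
    thus ?thesis by simp
  qed
  have "real p * fact k * fact m * pochhammer a (k + 1) * pochhammer (1 - a) m
      = (real p * a) * (fact k * fact m) * (pochhammer (a + 1) k * pochhammer (1 - a) m)"
    by (simp add: pochhammer_rec mult_ac)
  also have "\<dots> < (fact k * fact m) * (fact (k + 1) * fact m)"
    unfolding a(3) using lt by simp
  also have "\<dots> \<le> fact (k + m) * fact (k + 1 + m)"
    by (intro mult_mono f) auto
  also have "k + 1 + m = k + m + 1" by simp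
  finally show ?thesis
    unfolding pade_alpha_def a_def[symmetric] by (simp del: fact_Suc)
qed


section \<open>The residual\<close>

lemma pochhammer_minus_of_nat:
  "pochhammer (- of_nat m) j = (- 1) ^ j * fact j * (of_nat (m choose j) :: 'a::field_char_0)"
proof -
  have "of_nat (m choose j) = (- 1) ^ j * pochhammer (- of_nat m) j / (fact j :: 'a)"
    unfolding binomial_gbinomial gbinomial_pochhammer ..
  thus ?thesis by (simp add: power_mult_distrib[symmetric] mult.assoc[symmetric])
qed

lemma pade_coeff_altdef:
  fixes a :: "'a::field_char_0"
  assumes "j \<le> m"
  shows "pochhammer (- of_nat m) j * pochhammer (- a - of_nat k) j / (fact j * pochhammer (- of_nat k - of_nat m) j)
    = pade_coeff a k m j"
proof -
  have "- of_nat k - of_nat m = (- of_nat (k + m) :: 'a)" by simp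
  moreover have "of_nat (k + m choose j) = (fact (k + m) / (fact j * fact (k + m - j)) :: 'a)"
    using assms by (intro binomial_fact) simp
  ultimately show ?thesis
    unfolding pade_coeff_def by (simp only: pochhammer_minus_of_nat) simp
qed

lemma poly_pade_poly: "poly (pade_poly a k m) z = (\<Sum>j=0..m. pade_coeff a k m j * z ^ j)"
  by (simp add: pade_poly_def poly_sum poly_monom atLeast0AtMost)

lemma pade_den_eq_poly: "pade_den p k m z = poly (pade_poly (1 / of_nat p) k m) z"
  unfolding pade_den_def poly_pade_poly by (intro sum.cong refl) (simp add: pade_coeff_altdef)

lemma pade_num_eq_poly: "pade_num p k m z = poly (pade_poly (- (1 / of_nat p)) m k) z"
  unfolding pade_num_def poly_pade_poly
proof (intro sum.cong refl)
  fix j assume "j \<in> {0..k}"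
  hence "pade_coeff (- (1 / of_nat p)) m k j =
     pochhammer (- of_nat k) j * pochhammer (- (- (1 / of_nat p)) - of_nat m) j / (fact j * pochhammer (- of_nat m - of_nat k) j :: complex)"
    by (intro pade_coeff_altdef[symmetric]) simp
  also have "- of_nat m - of_nat k = (- of_nat k - of_nat m :: complex)" by simp
  finally show "pochhammer (- of_nat k) j * pochhammer (1 / of_nat p - of_nat m) j / (fact j * pochhammer (- of_nat k - of_nat m) j) * z ^ j
      = pade_coeff (- (1 / of_nat p)) m k j * z ^ j" by simp
qed


section \<open>The residual series, its derivative and its bound\<close>

context
  fixes p k m :: nat
  assumes p: "p \<ge> 2" and km: "m \<le> Suc k" "k + m \<ge> 1"
begin

private definition P where "P = pade_poly (- complex_of_real (1 / real p)) m k"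
private definition Q where "Q = pade_poly (complex_of_real (1 / real p)) k m"
private definition U where "U = fps_of_poly P * inverse (fps_of_poly Q)"

definition pade_residual :: "complex fps" where
  "pade_residual = 1 - (1 - fps_X) * U ^ p"

private lemma a01: "0 < 1 / real p" "1 / real p < 1"
  using p by auto

private lemma Q_nz: "norm z \<le> 1 \<Longrightarrow> poly Q z \<noteq> 0"
  unfolding Q_def by (rule pade_nonneg(3)[OF a01 km])

private lemma U_nonneg: "fps_nonneg U" and inverse_Q_nonneg: "fps_nonneg (inverse (fps_of_poly Q))"
  unfolding U_def P_def Q_def by (rule pade_nonneg[OF a01 km])+

private lemma conv_radius_inverse_Q: "fps_conv_radius (inverse (fps_of_poly Q)) \<ge> 1"
  using fps_conv_radius_inverse[of 1 "fps_of_poly Q"] Q_nz by (simp add: one_ereal_def)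

private lemma conv_radius_U: "fps_conv_radius U \<ge> 1"
  using conv_radius_inverse_Q fps_conv_radius_mult[of "fps_of_poly P" "inverse (fps_of_poly Q)"]
  by (simp add: U_def)

lemma conv_radius_pade_residual: "fps_conv_radius pade_residual \<ge> 1"
proof -
  have "fps_conv_radius (U ^ p) \<ge> 1"
    using conv_radius_U fps_conv_radius_power[of U p] by (rule order_trans)
  moreover have "fps_conv_radius (1 - fps_X :: complex fps) \<ge> 1"
    using fps_conv_radius_diff[of "1 :: complex fps" fps_X] by simp
  ultimately have "fps_conv_radius ((1 - fps_X) * U ^ p) \<ge> 1"
    using fps_conv_radius_mult[of "1 - fps_X" "U ^ p"] by (meson min.boundedI order_trans)
  thus ?thesis
    using fps_conv_radius_diff[of 1 "(1 - fps_X) * U ^ p"] by (simp add: pade_residual_def)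
qed

private lemma eval_U:
  assumes "norm z < 1"
  shows "eval_fps U z = poly P z / poly Q z"
proof -
  have z: "ereal (norm z) < 1" using assms by (simp add: one_ereal_def)
  have "eval_fps U z = poly P z * eval_fps (inverse (fps_of_poly Q)) z"
    unfolding U_def using less_le_trans[OF z conv_radius_inverse_Q] by (subst eval_fps_mult) auto
  also have "eval_fps (inverse (fps_of_poly Q)) z = inverse (poly Q z)"
    using z Q_nz by (subst eval_fps_inverse[of 1]) (auto simp: one_ereal_def)
  finally show ?thesis by (simp add: field_simps)
qed

lemma eval_pade_residual:
  assumes "norm z < 1"
  shows "eval_fps pade_residual z = 1 - (1 - z) * eval_fps U z ^ p"
proof -
  have z: "ereal (norm z) < 1" using assms by (simp add: one_ereal_def)
  have rU: "ereal (norm z) < fps_conv_radius U"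
    using z conv_radius_U by (rule less_le_trans)
  have rUp: "ereal (norm z) < fps_conv_radius (U ^ p)"
    using rU fps_conv_radius_power[of U p] by (rule less_le_trans)
  have rX: "ereal (norm z) < fps_conv_radius (1 - fps_X :: complex fps)"
    using fps_conv_radius_diff[of "1 :: complex fps" fps_X] by simp
  have rM: "ereal (norm z) < fps_conv_radius ((1 - fps_X) * U ^ p)"
    using fps_conv_radius_mult[of "1 - fps_X" "U ^ p"] rUp rX by (meson less_le_trans min_less_iff_conj)
  show ?thesis
    unfolding pade_residual_def using rU rUp rX rM
    by (simp add: eval_fps_diff eval_fps_mult eval_fps_power)
qed

private lemma U_0: "fps_nth U 0 = 1" and Q_0: "fps_nth (fps_of_poly Q) 0 = 1"
  by (simp_all add: U_def P_def Q_def coeff_pade_poly)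

lemma deriv_pade_residual:
  "fps_deriv pade_residual =
     fps_X ^ (k + m) * (fps_const (of_real (pade_alpha p k m * real (k + m + 1))) * U ^ (p - 1) * inverse (fps_of_poly Q) ^ 2)"
proof -
  define a where "a = complex_of_real (1 / real p)"
  define f g where "f = fps_of_poly P" and "g = fps_of_poly Q"
  have gg: "g * inverse g = 1"
    using Q_0 inverse_mult_eq_1'[of g] by (simp add: g_def)
  have dU: "fps_deriv U = (fps_deriv f * g - f * fps_deriv g) * inverse g ^ 2"
  proof -
    have "fps_deriv U = fps_deriv f * inverse g - f * fps_deriv g * inverse g ^ 2"
      using Q_0 by (simp add: U_def f_def[symmetric] g_def[symmetric] fps_inverse_deriv)
    also have "fps_deriv f * inverse g = fps_deriv f * (g * inverse g) * inverse g"
      by (simp add: gg)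
    finally show ?thesis by (simp add: algebra_simps power2_eq_square)
  qed
  \<comment> \<open>One factor \<open>U\<close> is written over \<open>g^2\<close>, to match the
    denominator of \<open>fps_deriv U\<close>.\<close>
  have Up: "U ^ p = U ^ (p - 1) * (f * g * inverse g ^ 2)"
  proof -
    have "f * g * inverse g ^ 2 = f * inverse g * (g * inverse g)"
      by (simp add: power2_eq_square mult_ac)
    also have "\<dots> = U" unfolding gg U_def f_def[symmetric] g_def[symmetric] by simp
    finally show ?thesis using p by (cases p) (simp_all add: mult.commute)
  qed
  have "fps_deriv pade_residual = U ^ p - (1 - fps_X) * (fps_const (of_nat p) * fps_deriv U * U ^ (p - 1))"
    unfolding pade_residual_def by (simp add: fps_deriv_power algebra_simps)
  also have "\<dots> = U ^ (p - 1) * inverse g ^ 2 *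
      (f * g - (1 - fps_X) * (fps_const (of_nat p) * (fps_deriv f * g - f * fps_deriv g)))"
    unfolding Up dU by (simp add: algebra_simps)
  \<comment> \<open>As \<open>p a = 1\<close>, taking out the factor \<open>p\<close> exposes the
    Wronskian.\<close>
  also have "f * g - (1 - fps_X) * (fps_const (of_nat p) * (fps_deriv f * g - f * fps_deriv g))
     = fps_const (of_nat p) * (fps_const a * (f * g) - (1 - fps_X) * (fps_deriv f * g - f * fps_deriv g))"
  proof -
    have "fps_const (of_nat p) * (fps_const a * (f * g)) = f * g"
      using p by (simp add: mult.assoc[symmetric] a_def)
    thus ?thesis by (simp add: algebra_simps)
  qed
  also have "fps_const a * (f * g) - (1 - fps_X) * (fps_deriv f * g - f * fps_deriv g) = fps_of_poly (pade_wronskian a k m)"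
    by (simp add: pade_wronskian_def Let_def f_def g_def P_def Q_def a_def fps_of_poly_diff fps_of_poly_mult
        fps_of_poly_pderiv fps_of_poly_pCons)
  also have "\<dots> = fps_const (coeff (pade_wronskian a k m) (k + m)) * fps_X ^ (k + m)"
    by (subst pade_wronskian_eq_monom) (simp add: fps_of_poly_monom)
  also have "U ^ (p - 1) * inverse g ^ 2 * (fps_const (of_nat p) * (fps_const (coeff (pade_wronskian a k m) (k + m)) * fps_X ^ (k + m)))
     = fps_X ^ (k + m) * (fps_const (of_nat p * coeff (pade_wronskian a k m) (k + m)) * U ^ (p - 1) * inverse g ^ 2)"
    by (simp add: mult_ac fps_const_mult[symmetric] del: fps_const_mult)
  also have "of_nat p * coeff (pade_wronskian a k m) (k + m) = of_real (pade_alpha p k m * real (k + m + 1))"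
  proof -
    have "pochhammer a (k + 1) = of_real (pochhammer (1 / real p) (k + 1))"
      unfolding a_def by (rule pochhammer_of_real)
    moreover have "pochhammer (1 - a) m = of_real (pochhammer (1 - 1 / real p) m)"
      unfolding a_def by (simp add: pochhammer_of_real[symmetric])
    ultimately show ?thesis
      unfolding pade_alpha_mult coeff_pade_wronskian by simp
  qed
  finally show ?thesis by (simp add: g_def)
qed

lemma norm_pade_residual_le:
  assumes "norm z < 1"
  shows "norm (1 - (1 - z) * (pade_num p k m z / pade_den p k m z) ^ p) \<le>
    norm z ^ (k + m + 1) * (pade_alpha p k m + (1 - pade_alpha p k m) * norm z)"
proof -
  define H where "H = fps_const (complex_of_real (pade_alpha p k m * real (k + m + 1))) * U ^ (p - 1) * inverse (fps_of_poly Q) ^ 2"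
  have H: "fps_nonneg H"
    unfolding H_def using pade_alpha_nonneg[OF p, of k m]
    by (intro fps_nonneg_mult fps_nonneg_power U_nonneg inverse_Q_nonneg) simp
  have H0: "fps_nth H 0 = of_real (pade_alpha p k m * real (k + m + 1))"
    using U_0 Q_0 by (simp add: H_def fps_nth_power_0)
  \<comment> \<open>Termwise integration of the derivative \<open>z^(k+m) H\<close>: coefficient
    \<open>n + 1\<close> comes from coefficient \<open>n - (k + m)\<close> of
    \<open>H\<close>.\<close>
  have Suc: "fps_nth pade_residual (Suc n) = (if n < k + m then 0 else fps_nth H (n - (k + m)) / of_nat (Suc n))" for n
  proof -
    have "of_nat (Suc n) * fps_nth pade_residual (Suc n) = fps_nth (fps_deriv pade_residual) n"
      by simp
    hence "of_nat (Suc n) * fps_nth pade_residual (Suc n) = (if n < k + m then 0 else fps_nth H (n - (k + m)))"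
      by (simp only: deriv_pade_residual H_def fps_X_power_mult_nth)
    thus ?thesis by (auto simp: field_simps simp del: of_nat_Suc)
  qed
  \<comment> \<open>The derivative leaves the constant term open; it vanishes because
    \<open>P\<close> and \<open>Q\<close> both equal \<open>1\<close> at \<open>0\<close>.\<close>
  have zero: "fps_nth pade_residual 0 = 0"
    using U_0 by (simp add: pade_residual_def fps_nth_power_0)
  have "norm (eval_fps pade_residual z) \<le> norm z ^ (k + m + 1) * (pade_alpha p k m + (1 - pade_alpha p k m) * norm z)"
  proof (rule norm_eval_fps_le[OF _ conv_radius_pade_residual])
    show "fps_nonneg pade_residual"
      unfolding fps_nonneg_def
    proof
      fix n show "fps_nth pade_residual n \<in> \<real>\<^sub>\<ge>\<^sub>0"
        using H by (cases n) (auto simp: zero Suc fps_nonneg_def simp del: of_nat_Suc)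
    qed
    show "fps_nth pade_residual n = 0" if "n < k + m + 1" for n
      using that by (cases n) (auto simp: zero Suc)
    show "fps_nth pade_residual (k + m + 1) = of_real (pade_alpha p k m)"
      using Suc[of "k + m"] H0 by (simp del: of_nat_Suc of_nat_add)
    fix t :: real assume t: "0 < t" "t < 1"
    \<comment> \<open>At real \<open>t\<close> in \<open>(0, 1)\<close> a nonnegative value of
      \<open>U\<close> makes \<open>(1 - t) U^p\<close> nonnegative, so the residual is at most
      \<open>1\<close>.\<close>
    have "eval_fps U (of_real t) \<in> \<real>\<^sub>\<ge>\<^sub>0"
      using t
      by (intro eval_fps_nonneg U_nonneg less_le_trans[OF _ conv_radius_U]) (auto simp: one_ereal_def)
    then obtain v where v: "eval_fps U (of_real t) = of_real v" "v \<ge> 0" by (rule nonneg_Reals_cases)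
    have "eval_fps pade_residual (of_real t) = of_real (1 - (1 - t) * v ^ p)"
      using t by (subst eval_pade_residual) (simp_all add: v)
    thus "Re (eval_fps pade_residual (of_real t)) \<le> 1"
      using t v(2) by simp
  qed (use assms in auto)
  thus ?thesis
    using assms by (simp add: eval_pade_residual eval_U P_def Q_def pade_num_eq_poly pade_den_eq_poly)
qed

end

section \<open>Iterating the residual bound\<close>

lemma power_diff_one_div_Suc:
  assumes "n > 0"
  shows "((n + 1) ^ Suc l - 1) div n = (n + 1) * (((n + 1) ^ l - 1) div n) + (1 :: nat)"
proof -
  \<comment> \<open>The quotient is a geometric sum; splitting off its first term yields the
    recurrence.\<close>
  have e: "((n + 1) ^ l - 1) div n = (\<Sum>i<l. (n + 1) ^ i)" for l
  proof -
    have "(n + 1) ^ l = 1 + n * (\<Sum>i<l. (n + 1) ^ i)"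
      by (induction l) (simp_all add: algebra_simps)
    thus ?thesis using assms by simp
  qed
  show ?thesis unfolding e
    by (simp only: sum.lessThan_Suc_shift sum_distrib_left power_Suc) simp
qed

(* The natural-number quotient in the last exponent is exact: (n + 1)^l - 1 is a multiple of n. *)
theorem theorem2p5:
  fixes p k m :: nat and x :: "nat \<Rightarrow> complex"
  assumes "p \<ge> 2"
    and "int k \<ge> int m - 1"
    and "k + m \<ge> 1"
    and "cmod (1 - x 0 ^ p) < 1"
    and "\<And>l. x (Suc l) = x l * (pade_num p k m (1 - x l ^ p) / pade_den p k m (1 - x l ^ p))"
  shows "pade_alpha p k m < 1 \<and>
    (\<forall>l. cmod (1 - x l ^ p) \<le>
           cmod (1 - x 0 ^ p) ^ ((k + m + 1) ^ l) *
           ((cmod (1 - x 0 ^ p) + pade_alpha p k m) / (1 + pade_alpha p k m * cmod (1 - x 0 ^ p)))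
             ^ (((k + m + 1) ^ l - 1) div (k + m)))"
proof -
  define \<alpha> where "\<alpha> = pade_alpha p k m"
  define y where "y l = cmod (1 - x l ^ p)" for l
  define q where "q = (y 0 + \<alpha>) / (1 + \<alpha> * y 0)"
  define N where "N = k + m + 1"
  have \<alpha>: "0 \<le> \<alpha>" "\<alpha> < 1"
    unfolding \<alpha>_def using assms pade_alpha_nonneg pade_alpha_less_1 by auto
  have y0: "0 \<le> y 0" "y 0 < 1" using assms by (auto simp: y_def)
  have den: "1 + \<alpha> * y 0 > 0" using \<alpha> y0 by (simp add: add_pos_nonneg)
  \<comment> \<open>This product is the denominator of \<open>q\<close> minus its numerator, whence
    \<open>q \<le> 1\<close>.\<close>
  have "(1 - \<alpha>) * (1 - y 0) \<ge> 0" using \<alpha> y0 by simp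
  hence q: "0 \<le> q" "q \<le> 1"
    using \<alpha> y0 den by (auto simp: q_def field_simps)
  have chord: "\<alpha> + (1 - \<alpha>) * y 0 \<le> q"
  proof -
    \<comment> \<open>Exactly the gap between the two sides once the inequality is multiplied by
      \<open>1 + \<alpha> * y 0\<close>.\<close>
    have "0 \<le> \<alpha> * (1 - \<alpha>) * (y 0 * (1 - y 0))" using \<alpha> y0 by simp
    hence "(\<alpha> + (1 - \<alpha>) * y 0) * (1 + \<alpha> * y 0) \<le> y 0 + \<alpha>" by (simp add: algebra_simps)
    thus ?thesis unfolding q_def using den by (simp add: pos_le_divide_eq)
  qed
  have step: "y (Suc l) \<le> y l ^ N * (\<alpha> + (1 - \<alpha>) * y l)" if "y l < 1" for l
  proof -
    have "1 - x (Suc l) ^ p = 1 - (1 - (1 - x l ^ p)) * (pade_num p k m (1 - x l ^ p) / pade_den p k m (1 - x l ^ p)) ^ p"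
      unfolding assms(5) by (simp only: power_mult_distrib) simp
    thus ?thesis
      using norm_pade_residual_le[of p m k "1 - x l ^ p"] assms that by (simp add: y_def N_def \<alpha>_def)
  qed
  have "y l \<le> y 0 ^ (N ^ l) * q ^ ((N ^ l - 1) div (k + m))" for l
  proof (induction l)
    case 0
    show ?case by simp
  next
    case (Suc l)
    define e where "e = (N ^ l - 1) div (k + m)"
    \<comment> \<open>Since \<open>N ^ l \<ge> 1\<close>, the induction hypothesis also gives
      \<open>y l \<le> y 0\<close>: the iterate stays in the unit disc, where \<open>step\<close>
      applies.\<close>
    have "y 0 ^ (N ^ l) * q ^ e \<le> y 0 ^ 1 * 1"
      using y0 q by (intro mult_mono power_decreasing power_le_one) (auto simp: N_def)
    with Suc.IH have le: "y l \<le> y 0" by (simp add: e_def)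
    have "y (Suc l) \<le> y l ^ N * (\<alpha> + (1 - \<alpha>) * y l)"
      using le y0 by (intro step) simp
    also have "\<dots> \<le> (y 0 ^ (N ^ l) * q ^ e) ^ N * q"
    proof (intro mult_mono power_mono)
      \<comment> \<open>The linear factor is increasing, so its value at \<open>y 0\<close> serves
        for every \<open>l\<close>; each iteration contributes one further factor
        \<open>q\<close>.\<close>
      have "\<alpha> + (1 - \<alpha>) * y l \<le> \<alpha> + (1 - \<alpha>) * y 0" using le \<alpha> by (simp add: mult_left_mono)
      thus "\<alpha> + (1 - \<alpha>) * y l \<le> q" using chord by simp
    qed (use Suc.IH \<alpha> y0 q in \<open>auto simp: e_def y_def\<close>)
    also have "\<dots> = y 0 ^ (N ^ Suc l) * q ^ (N * e + 1)"
      by (simp add: power_mult_distrib power_mult[symmetric] mult_ac)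
    also have "N * e + 1 = (N ^ Suc l - 1) div (k + m)"
      using power_diff_one_div_Suc[of "k + m" l] assms(3) by (simp only: N_def e_def)
    finally show ?case .
  qed
  thus ?thesis using \<alpha>(2) by (simp add: \<alpha>_def y_def q_def N_def)
qed

end
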